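(* Let $T$ be a tree of diameter $4$ with $n$ vertices, and let $\overline{d} = 2 - \frac{2}{n}$ (the average vertex degree of $T$). Then $m_T[0,\overline{d}) \geq \left\lceil \frac{n}{2} \right\rceil$, i.e., at least $\lceil n/2 \rceil$ of the Laplacian eigenvalues of $T$ (counted with multiplicity) lie in the interval $[0, 2 - \frac{2}{n})$.
   Context: For a graph $G$ with adjacency matrix $A$, the Laplacian matrix is $L = D - A$, where $D$ is the diagonal matrix of vertex degrees; the Laplacian eigenvalues of $G$ are the eigenvalues of $L$, counted with multiplicity. For a real interval $I$, $m_G(I)$ denotes the number of Laplacian eigenvalues of $G$ (counted with multiplicity) lying in $I$. The diameter of a tree is the maximum distance (number of edges on a shortest path) between two of its vertices. *)

theory Defs
  imports
    "Jordan_Normal_Form.Char_Poly"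
    "Graph_Theory.Graph_Theory"
    "HOL-Computational_Algebra.Polynomial"
begin

text \<open>
  Finite simple graphs are the locale \<^locale>\<open>graph\<close>: finite symmetric digraphs without loops and
  parallel arcs, each edge being represented by its two opposite arcs.

  The constant \<^const>\<open>tree\<close> of the library cannot be used for such graphs: there, the closed walk
  a, b, a along an edge and back is a cycle, so a symmetric digraph with an edge is never a
  \<^const>\<open>tree\<close>.  In a simple graph the cycles in the undirected sense are exactly those of length
  at least 3.
\<close>

definition undirected_tree :: "('a, 'b) pre_digraph \<Rightarrow> bool" where
  "undirected_tree G \<longleftrightarrow>
     graph G \<and> Digraph_Component.connected G \<and>
     \<not> (\<exists>p. pre_digraph.cycle G p \<and> length p \<ge> 3)"

text \<open>Only meaningful for \<open>u\<close> and \<open>v\<close> in the same component.\<close>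

definition vert_dist :: "('a, 'b) pre_digraph \<Rightarrow> 'a \<Rightarrow> 'a \<Rightarrow> nat" where
  "vert_dist G u v = (LEAST k. \<exists>p. pre_digraph.apath G u p v \<and> length p = k)"

definition diameter :: "('a, 'b) pre_digraph \<Rightarrow> nat" where
  "diameter G = Max {vert_dist G u v | u v. u \<in> verts G \<and> v \<in> verts G}"

text \<open>
  Matrices are indexed by natural numbers, so an enumeration of the vertices is fixed.
  Another enumeration conjugates the matrices below by a permutation matrix, which does not
  affect the characteristic polynomial.
\<close>

definition vert_list :: "('a, 'b) pre_digraph \<Rightarrow> 'a list" where
  "vert_list G = (SOME vs. distinct vs \<and> set vs = verts G)"

definition adjacency_matrix :: "('a, 'b) pre_digraph \<Rightarrow> real mat" where
  "adjacency_matrix G = (let vs = vert_list G; n = card (verts G) in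
     mat n n (\<lambda>(i, j). if (vs ! i, vs ! j) \<in> arcs_ends G then 1 else 0))"

definition degree_matrix :: "('a, 'b) pre_digraph \<Rightarrow> real mat" where
  "degree_matrix G = (let vs = vert_list G; n = card (verts G) in
     mat n n (\<lambda>(i, j). if i = j then real (out_degree G (vs ! i)) else 0))"

definition laplacian_matrix :: "('a, 'b) pre_digraph \<Rightarrow> real mat" where
  "laplacian_matrix G = degree_matrix G - adjacency_matrix G"

definition laplacian_eigenvalues :: "('a, 'b) pre_digraph \<Rightarrow> real multiset" where
  "laplacian_eigenvalues G = proots (char_poly (laplacian_matrix G))"

definition laplacian_count :: "('a, 'b) pre_digraph \<Rightarrow> real set \<Rightarrow> nat" where
  "laplacian_count G I = size {#x \<in># laplacian_eigenvalues G. x \<in> I#}"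

lemma vert_list:
  assumes "finite (verts G)"
  shows "distinct (vert_list G)" "set (vert_list G) = verts G"
    "length (vert_list G) = card (verts G)"
proof -
  have "\<exists>vs. distinct vs \<and> set vs = verts G"
    using finite_distinct_list[OF assms] by blast
  then have "distinct (vert_list G) \<and> set (vert_list G) = verts G"
    unfolding vert_list_def by (rule someI_ex)
  then show "distinct (vert_list G)" "set (vert_list G) = verts G"
    "length (vert_list G) = card (verts G)"
    using distinct_card by force+
qed

end

theory Submission
  imports Defs "Jordan_Normal_Form.Spectral_Radius"
begin

text \<open>
  By Courant--Fischer it suffices to find a space of dimension at least \<open>n / 2\<close> on which the
  Laplacian form is less than \<open>d\<close> times the squared norm.  A tree of diameter 4 has a centre \<open>c\<close>
  such that every non-leaf other than \<open>c\<close> is adjacent to \<open>c\<close> and to some leaf.  Vectors supported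
  on the leaves have Rayleigh quotient \<open>1 < d\<close>, so the theorem follows if at least half of the
  vertices are leaves.  Otherwise every neighbour of \<open>c\<close> carries exactly one leaf and there are no
  further leaves; then \<open>n = 2 * r + 1\<close> with \<open>r\<close> leaves, and the required extra dimension comes from
  a vector with constant value on the neighbours of \<open>c\<close>.
\<close>

subsection \<open>Real symmetric matrices\<close>

lemma real_scalar_prod_self_ge_0: "0 \<le> (v :: real vec) \<bullet> v"
  by (simp add: scalar_prod_def sum_nonneg)

lemma real_scalar_prod_self_eq_0_iff:
  assumes "(v :: real vec) \<in> carrier_vec n"
  shows "v \<bullet> v = 0 \<longleftrightarrow> v = 0\<^sub>v n"
  using assms by (auto simp: scalar_prod_def sum_nonneg_eq_0_iff intro!: eq_vecI)

text \<open>For an eigenvector \<open>z\<close>, the form \<open>q = z* A z\<close> equals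
  \<open>c\<close> times the squared norm of \<open>z\<close>. Since \<open>A\<close> is real and
  symmetric, \<open>q\<close> is its own conjugate.\<close>

lemma symmetric_mat_complex_eigenvalue_real:
  fixes A :: "real mat"
  assumes A: "A \<in> carrier_mat n n" and sym: "transpose_mat A = A"
    and ev: "eigenvalue (map_mat complex_of_real A) c"
  shows "Im c = 0"
proof -
  let ?B = "map_mat complex_of_real A"
  have B: "?B \<in> carrier_mat n n" using A by simp
  have A_sym: "A $$ (i, j) = A $$ (j, i)" if "i < n" "j < n" for i j
    using that A sym by (metis carrier_matD index_transpose_mat(1))
  obtain z where z: "z \<in> carrier_vec n" "z \<noteq> 0\<^sub>v n" and Bz: "?B *\<^sub>v z = c \<cdot>\<^sub>v z"
    using ev B unfolding eigenvalue_def eigenvector_def by auto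
  have row: "(\<Sum>j<n. complex_of_real (A $$ (i, j)) * z $ j) = c * z $ i" if "i < n" for i
  proof -
    have "(\<Sum>j<n. complex_of_real (A $$ (i, j)) * z $ j) = (?B *\<^sub>v z) $ i"
      using that A z(1) by (auto simp: scalar_prod_def lessThan_atLeast0 intro!: sum.cong)
    then show ?thesis using that z(1) by (simp add: Bz)
  qed
  define S where "S = (\<Sum>i<n. (cmod (z $ i))\<^sup>2)"
  define q where "q = (\<Sum>i<n. \<Sum>j<n. cnj (z $ i) * (complex_of_real (A $$ (i, j)) * z $ j))"
  have "q = (\<Sum>i<n. cnj (z $ i) * (\<Sum>j<n. complex_of_real (A $$ (i, j)) * z $ j))"
    by (simp add: q_def sum_distrib_left)
  also have "\<dots> = (\<Sum>i<n. c * complex_of_real ((cmod (z $ i))\<^sup>2))"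
    unfolding complex_norm_square by (intro sum.cong) (simp_all add: row)
  finally have "q = (\<Sum>i<n. c * complex_of_real ((cmod (z $ i))\<^sup>2))" .
  then have q: "q = c * complex_of_real S"
    by (simp add: S_def sum_distrib_left)
  have "cnj q = (\<Sum>i<n. \<Sum>j<n. z $ i * (complex_of_real (A $$ (i, j)) * cnj (z $ j)))"
    by (simp add: q_def)
  also have "\<dots> = (\<Sum>j<n. \<Sum>i<n. z $ i * (complex_of_real (A $$ (i, j)) * cnj (z $ j)))"
    by (rule sum.swap)
  also have "\<dots> = q" unfolding q_def
    by (intro sum.cong) (auto simp: A_sym)
  finally have "Im q = 0" by (metis Reals_cnj_iff complex_is_Real_iff)
  moreover obtain i where "i < n" "z $ i \<noteq> 0"
    using z by (metis carrier_vecD eq_vecI index_zero_vec)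
  then have "S > 0" unfolding S_def
    by (intro sum_pos2[of _ i]) auto
  ultimately show ?thesis by (simp add: q)
qed

text \<open>Over the complex numbers some eigenvalue exists. It is real by symmetry, hence a root of
  the real characteristic polynomial, and so has a real eigenvector to normalise.\<close>

lemma symmetric_mat_unit_eigenvector:
  fixes A :: "real mat"
  assumes A: "A \<in> carrier_mat n n" and sym: "transpose_mat A = A" and n: "n > 0"
  obtains e v where "v \<in> carrier_vec n" "v \<bullet> v = 1" "A *\<^sub>v v = e \<cdot>\<^sub>v v"
proof -
  let ?B = "map_mat complex_of_real A"
  have B: "?B \<in> carrier_mat n n" using A by simp
  obtain c where c: "eigenvalue ?B c"
    using spectrum_non_empty[OF B n] by (auto simp: spectrum_def)
  then have "c = complex_of_real (Re c)"
    using symmetric_mat_complex_eigenvalue_real[OF A sym] by (simp add: complex_eq_iff)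
  moreover have "poly (map_poly complex_of_real (char_poly A)) c = 0"
    using c B of_real_hom.char_poly_hom[OF A, where 'a = complex]
    by (simp add: eigenvalue_root_char_poly)
  ultimately have "poly (char_poly A) (Re c) = 0"
    by (metis of_real_eq_0_iff of_real_hom.poly_map_poly)
  then have "eigenvalue A (Re c)" using A by (simp add: eigenvalue_root_char_poly)
  then obtain w where w: "w \<in> carrier_vec n" "w \<noteq> 0\<^sub>v n" "A *\<^sub>v w = Re c \<cdot>\<^sub>v w"
    using A unfolding eigenvalue_def eigenvector_def by auto
  define s where "s = w \<bullet> w"
  have s: "s > 0" 
    using w real_scalar_prod_self_ge_0[of w] real_scalar_prod_self_eq_0_iff[of w n]
    by (simp add: s_def less_le)
  let ?v = "(1 / sqrt s) \<cdot>\<^sub>v w"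
  show ?thesis
  proof (rule that[of ?v "Re c"])
    show "?v \<in> carrier_vec n" using w by simp
    show "?v \<bullet> ?v = 1" using w s by (simp add: s_def[symmetric])
    show "A *\<^sub>v ?v = Re c \<cdot>\<^sub>v ?v"
      using A w by (simp add: mult_mat_vec smult_smult_assoc mult.commute)
  qed
qed

section \<open>Householder reflections and the spectral theorem\<close>

text \<open>For \<open>u = 0\<close> this is the identity, since division by zero yields zero.\<close>

definition householder :: "nat \<Rightarrow> real vec \<Rightarrow> real mat" where
  "householder n u = mat n n (\<lambda>(i, j). (if i = j then 1 else 0) - 2 / (u \<bullet> u) * u $ i * u $ j)"

lemma householder_carrier [simp]: "householder n u \<in> carrier_mat n n"
  by (simp add: householder_def)

lemma transpose_householder [simp]: "transpose_mat (householder n u) = householder n u"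
  by (rule eq_matI) (auto simp: householder_def)

lemma householder_mult_vec:
  assumes u: "u \<in> carrier_vec n" and x: "x \<in> carrier_vec n"
  shows "householder n u *\<^sub>v x = x - (2 / (u \<bullet> u) * (u \<bullet> x)) \<cdot>\<^sub>v u"
proof (rule eq_vecI)
  define c where "c = 2 / (u \<bullet> u)"
  fix i assume "i < dim_vec (x - (2 / (u \<bullet> u) * (u \<bullet> x)) \<cdot>\<^sub>v u)"
  then have i: "i < n" using u by simp
  have "(householder n u *\<^sub>v x) $ i
      = (\<Sum>j\<in>{0..<n}. ((if i = j then 1 else 0) - c * u $ i * u $ j) * x $ j)"
    using i x unfolding c_def by (simp add: householder_def scalar_prod_def[of _ x])
  also have "\<dots> = (\<Sum>j\<in>{0..<n}. (if i = j then x $ j else 0) - (c * u $ i) * (u $ j * x $ j))"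
    by (intro sum.cong) (auto simp: algebra_simps)
  also have "\<dots> = x $ i - c * u $ i * (u \<bullet> x)"
    using i x by (simp add: sum_subtractf sum_distrib_left[symmetric] scalar_prod_def)
  finally show "(householder n u *\<^sub>v x) $ i = (x - (2 / (u \<bullet> u) * (u \<bullet> x)) \<cdot>\<^sub>v u) $ i"
    using i u x by (simp add: c_def)
qed (use u in \<open>simp add: householder_def\<close>)

lemma householder_self_inverse:
  assumes u: "u \<in> carrier_vec n"
  shows "householder n u * householder n u = 1\<^sub>m n"
proof (rule eq_matI)
  define c where "c = 2 / (u \<bullet> u)"
  \<comment> \<open>Also true for \<open>u = 0\<close>, where \<open>c = 0\<close>; this identity
    cancels the cross terms below.\<close>
  have c: "c * c * (u \<bullet> u) = 2 * c" by (simp add: c_def)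
  fix i j assume "i < dim_row (1\<^sub>m n :: real mat)" "j < dim_col (1\<^sub>m n :: real mat)"
  then have ij: "i < n" "j < n" by auto
  have "(householder n u * householder n u) $$ (i, j)
      = (\<Sum>k\<in>{0..<n}. ((if i = k then 1 else 0) - c * u $ i * u $ k) *
          ((if k = j then 1 else 0) - c * u $ k * u $ j))"
    using ij unfolding c_def by (simp add: householder_def scalar_prod_def[of "vec n _"])
  also have "\<dots> = (\<Sum>k\<in>{0..<n}. (if k = i then if i = j then 1 else 0 else 0)
          - (if k = i then c * u $ k * u $ j else 0)
          - (if k = j then c * u $ i * u $ k else 0) + (c * c * u $ i * u $ j) * (u $ k * u $ k))"
    by (intro sum.cong) (auto simp: algebra_simps)
  also have "\<dots> = (if i = j then 1 else 0) - 2 * c * u $ i * u $ j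
      + (c * c * u $ i * u $ j) * (u \<bullet> u)"
    using ij u unfolding scalar_prod_def by (simp add: sum.distrib sum_subtractf sum_distrib_left[symmetric])
  also have "\<dots> = (if i = j then 1 else 0)" using c by (auto simp: algebra_simps)
  finally show "(householder n u * householder n u) $$ (i, j) = 1\<^sub>m n $$ (i, j)"
    using ij by simp
qed (simp_all add: householder_def)

text \<open>Vectors of equal norm are exchanged by the reflection in the hyperplane orthogonal to
  their difference.\<close>

lemma householder_reflects_unit_vec:
  assumes v: "v \<in> carrier_vec n" "v \<bullet> v = 1" and n: "k < n"
  shows "householder n (v - unit_vec n k) *\<^sub>v unit_vec n k = v"
proof -
  let ?e = "unit_vec n k :: real vec"
  let ?u = "v - ?e"
  have u: "?u \<in> carrier_vec n" using v by simp
  have ue: "?u \<bullet> ?e = v $ k - 1" using v n by simp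
  have uu: "?u \<bullet> ?u = 2 - 2 * v $ k"
    using v n by (simp add: minus_scalar_prod_distrib[of _ n] scalar_prod_minus_distrib[of _ n])
  show ?thesis
  proof (cases "v $ k = 1")
    case True
    \<comment> \<open>Degenerate case: a unit vector with \<open>k\<close>-th entry 1 is
      \<open>?e\<close>, and the reflection becomes the identity.\<close>
    then have "?u = 0\<^sub>v n" using u uu by (simp add: real_scalar_prod_self_eq_0_iff[symmetric])
    then have "?u $ i = 0" if "i < n" for i using that by simp
    then have "v = ?e" using v by (intro eq_vecI) auto
    then show ?thesis using householder_mult_vec[OF u unit_vec_carrier] v by (intro eq_vecI) auto
  next
    case False
    then have "2 / (?u \<bullet> ?u) * (?u \<bullet> ?e) = -1"
      unfolding ue uu by (simp add: field_simps)
    then have "householder n ?u *\<^sub>v ?e = ?e - (-1) \<cdot>\<^sub>v ?u"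
      using householder_mult_vec[OF u unit_vec_carrier] by simp
    also have "\<dots> = v" using v by (intro eq_vecI) auto
    finally show ?thesis .
  qed
qed

text \<open>Induction on the size: conjugating by a reflection that exchanges the first basis vector
  with a unit eigenvector splits off a one-by-one block, and the induction hypothesis diagonalises
  the rest.\<close>

lemma real_symmetric_spectral_decomposition:
  fixes A :: "real mat"
  assumes "A \<in> carrier_mat n n" and "transpose_mat A = A"
  obtains P f where "P \<in> carrier_mat n n" "transpose_mat P * P = 1\<^sub>m n"
    "A = P * mat_diag n f * transpose_mat P"
  using assms
proof (induction n arbitrary: A thesis)
  case 0
  show ?case by (rule "0.prems"(1)[of "1\<^sub>m 0"]) (use "0.prems"(2) in auto)
next
  case (Suc m)
  note A = Suc.prems(2) and sym = Suc.prems(3)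
  obtain e v where v: "v \<in> carrier_vec (Suc m)" "v \<bullet> v = 1" "A *\<^sub>v v = e \<cdot>\<^sub>v v"
    using symmetric_mat_unit_eigenvector[OF A sym zero_less_Suc] by blast
  define H where "H = householder (Suc m) (v - unit_vec (Suc m) 0)"
  have H: "H \<in> carrier_mat (Suc m) (Suc m)" and Ht: "transpose_mat H = H" and HH: "H * H = 1\<^sub>m (Suc m)"
    using v(1) by (auto simp: H_def householder_self_inverse)
  have He: "H *\<^sub>v unit_vec (Suc m) 0 = v"
    using v by (simp add: H_def householder_reflects_unit_vec)
  have Hv: "H *\<^sub>v v = unit_vec (Suc m) 0"
    unfolding He[symmetric] using assoc_mult_mat_vec[OF H H, of "unit_vec (Suc m) 0"] HH by simp
  define B where "B = H * A * H"
  have B: "B \<in> carrier_mat (Suc m) (Suc m)" using H A by (simp add: B_def)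
  have Bt: "transpose_mat B = B"
    unfolding B_def using H A Ht sym
    by (simp add: transpose_mult[of _ "Suc m" "Suc m" _ "Suc m"] assoc_mult_mat[of _ "Suc m" "Suc m" _ "Suc m" _ "Suc m"])
  have Be: "B *\<^sub>v unit_vec (Suc m) 0 = e \<cdot>\<^sub>v unit_vec (Suc m) 0"
    unfolding B_def using A H He Hv v
    by (simp add: assoc_mult_mat_vec[of _ "Suc m" "Suc m" _ "Suc m"] mult_mat_vec[of _ "Suc m" "Suc m"] del: assoc_mult_mat)
  \<comment> \<open>The first column of \<open>B\<close> is \<open>e\<close> times the first basis
    vector; by symmetry so is the first row, and \<open>B\<close> is block diagonal.\<close>
  have col0: "B $$ (i, 0) = (if i = 0 then e else 0)" if "i < Suc m" for i
    using arg_cong[OF Be, of "\<lambda>x. x $ i"] that B by simp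
  have B_sym: "B $$ (i, j) = B $$ (j, i)" if "i < Suc m" "j < Suc m" for i j
    using that B Bt by (metis carrier_matD index_transpose_mat(1))
  define C where "C = mat m m (\<lambda>(i, j). B $$ (Suc i, Suc j))"
  have C: "C \<in> carrier_mat m m" "transpose_mat C = C"
    by (auto simp: C_def intro!: eq_matI B_sym)
  obtain Q g where Q: "Q \<in> carrier_mat m m" "transpose_mat Q * Q = 1\<^sub>m m"
    and CQ: "C = Q * mat_diag m g * transpose_mat Q"
    using Suc.IH[OF _ C] by blast
  define R where "R = four_block_mat (1\<^sub>m 1) (0\<^sub>m 1 m) (0\<^sub>m m 1) Q"
  define f where "f = case_nat e g"
  have R: "R \<in> carrier_mat (Suc m) (Suc m)"
    using four_block_carrier_mat[of "1\<^sub>m 1" 1 1 Q m m] Q by (simp add: R_def)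
  have Rt: "transpose_mat R = four_block_mat (1\<^sub>m 1) (0\<^sub>m 1 m) (0\<^sub>m m 1) (transpose_mat Q)"
    unfolding R_def using Q by (subst transpose_four_block_mat[of _ 1 1 _ m _ m]) auto
  have RR: "transpose_mat R * R = 1\<^sub>m (Suc m)"
    unfolding Rt unfolding R_def using Q
    by (subst mult_four_block_mat[of _ 1 1 _ m _ m _ _ 1 _ m]) auto
  have D: "mat_diag (Suc m) f = four_block_mat (e \<cdot>\<^sub>m 1\<^sub>m 1) (0\<^sub>m 1 m) (0\<^sub>m m 1) (mat_diag m g)"
    by (rule eq_matI) (auto simp: f_def mat_diag_def split: nat.split)
  have "B = four_block_mat (e \<cdot>\<^sub>m 1\<^sub>m 1) (0\<^sub>m 1 m) (0\<^sub>m m 1) C"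
    using B col0 B_sym[of 0] by (intro eq_matI) (auto simp: C_def)
  also have "\<dots> = R * mat_diag (Suc m) f * transpose_mat R"
  proof -
    have "R * mat_diag (Suc m) f = four_block_mat (e \<cdot>\<^sub>m 1\<^sub>m 1) (0\<^sub>m 1 m) (0\<^sub>m m 1) (Q * mat_diag m g)"
      unfolding R_def D using Q
      by (subst mult_four_block_mat[of _ 1 1 _ m _ m _ _ 1 _ m]) (auto simp: left_mult_zero_mat[of "mat_diag m g" m m])
    then show ?thesis
      unfolding Rt CQ using Q
      by (simp, subst mult_four_block_mat[of _ 1 1 _ m _ m _ _ 1 _ m])
        (auto simp: right_mult_zero_mat[of _ m m])
  qed
  finally have BR: "B = R * mat_diag (Suc m) f * transpose_mat R" .
  show ?case
  proof (rule Suc.prems(1)[of "H * R" f])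
    let ?n = "Suc m"
    have D': "mat_diag ?n f \<in> carrier_mat ?n ?n" by simp
    have t: "transpose_mat (H * R) = transpose_mat R * H"
      using transpose_mult[OF H R] Ht by simp
    show HR: "H * R \<in> carrier_mat ?n ?n" using H R by simp
    have "transpose_mat (H * R) * (H * R) = transpose_mat R * (H * H) * R"
      unfolding t using H R by (simp add: assoc_mult_mat[of _ ?n ?n _ ?n _ ?n])
    then show "transpose_mat (H * R) * (H * R) = 1\<^sub>m ?n"
      using R RR HH by simp
    \<comment> \<open>\<open>H\<close> is its own inverse, so \<open>A = H * B * H\<close>, and
      \<open>H\<close> carries the diagonalisation of \<open>B\<close> by \<open>R\<close> back to
      \<open>A\<close>.\<close>
    have "A = (H * H) * A * (H * H)" using A HH by simp
    also have "\<dots> = H * B * H"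
      unfolding B_def using A H by (simp add: assoc_mult_mat[of _ ?n ?n _ ?n _ ?n])
    also have "\<dots> = (H * R) * mat_diag ?n f * transpose_mat (H * R)"
      unfolding t BR using H R D' mult_carrier_mat[OF D', of "transpose_mat R" ?n]
        mult_carrier_mat[OF R, of "mat_diag ?n f * transpose_mat R" ?n] by (simp add: assoc_mult_mat[of _ ?n ?n _ ?n _ ?n])
    finally show "A = (H * R) * mat_diag ?n f * transpose_mat (H * R)" .
  qed
qed

section \<open>Counting eigenvalues through linear constraints\<close>

lemma exists_vec_orthogonal_to_few:
  fixes F :: "'a :: field vec set"
  assumes F: "finite F" "F \<subseteq> carrier_vec n" and card: "card F < n"
  obtains x where "x \<in> carrier_vec n" "x \<noteq> 0\<^sub>v n" "\<And>f. f \<in> F \<Longrightarrow> f \<bullet> x = 0"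
proof -
  obtain fs where fs: "set fs = F" "distinct fs"
    using finite_distinct_list[OF F(1)] by blast
  then have len: "length fs < n" using card by (simp add: distinct_card[symmetric])
  \<comment> \<open>Fewer than \<open>n\<close> equations are padded with zero rows to a square
    system. Its last row vanishes, so the determinant is zero and the kernel is nontrivial.\<close>
  define M where "M = mat_of_rows n (fs @ replicate (n - length fs) (0\<^sub>v n))"
  have M: "M \<in> carrier_mat n n" using len by (simp add: M_def mat_of_rows_def)
  have rowM: "row M i = (if i < length fs then fs ! i else 0\<^sub>v n)" if "i < n" for i
    using that fs(1) F(2) len nth_mem[of i fs] unfolding M_def
    by (subst mat_of_rows_row) (auto simp: nth_append)
  have "transpose_mat M *\<^sub>v unit_vec n (n - 1) = 0\<^sub>v n"
  proof (rule eq_vecI)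
    fix i assume "i < dim_vec (0\<^sub>v n :: 'a vec)"
    then have i: "i < n" by simp
    have "M $$ (n - 1, i) = row M (n - 1) $ i" using M i by simp
    also have "\<dots> = 0" using rowM[of "n - 1"] len i by simp
    finally show "(transpose_mat M *\<^sub>v unit_vec n (n - 1)) $ i = 0\<^sub>v n $ i"
      using M i by simp
  qed (use M in auto)
  moreover have "unit_vec n (n - 1) \<noteq> (0\<^sub>v n :: 'a vec)" using len by (simp add: unit_vec_nonzero)
  ultimately have "det (transpose_mat M) = 0"
    using M by (subst det_0_iff_vec_prod_zero[of _ n]) (auto intro!: exI[of _ "unit_vec n (n - 1)"])
  then have "det M = 0" using M by (simp add: det_transpose)
  then obtain x where x: "x \<in> carrier_vec n" "x \<noteq> 0\<^sub>v n" "M *\<^sub>v x = 0\<^sub>v n"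
    using M by (auto simp: det_0_iff_vec_prod_zero[of _ n])
  show ?thesis
  proof (rule that[OF x(1,2)])
    fix f assume "f \<in> F"
    then obtain i where i: "i < length fs" "f = fs ! i" using fs by (auto simp: in_set_conv_nth)
    then have "f \<bullet> x = (M *\<^sub>v x) $ i" using rowM[of i] len M by simp
    then show "f \<bullet> x = 0" using x(3) i len by simp
  qed
qed

lemma proots_prod_list_linear:
  "proots (\<Prod>a\<leftarrow>as. [:- a, 1:]) = mset (as :: 'a :: idom list)"
proof (induction as)
  case (Cons a as)
  have "(\<Prod>a\<leftarrow>as. [:- a, 1:]) \<noteq> 0" by (auto simp: prod_list_zero_iff)
  then have "proots ([:- a, 1:] * (\<Prod>a\<leftarrow>as. [:- a, 1:]))
      = proots [:- a, 1:] + proots (\<Prod>a\<leftarrow>as. [:- a, 1:])"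
    by (intro proots_mult) auto
  then show ?case using Cons.IH by (simp del: mult_pCons_left)
qed simp

text \<open>Courant--Fischer, with the test space given by the linear constraints \<open>F\<close>.\<close>

lemma eigenvalue_count_ge_codim:
  fixes A :: "real mat"
  assumes A: "A \<in> carrier_mat n n" and sym: "transpose_mat A = A"
    and psd: "\<And>x. x \<in> carrier_vec n \<Longrightarrow> 0 \<le> x \<bullet> (A *\<^sub>v x)"
    and F: "finite F" "F \<subseteq> carrier_vec n"
    and less: "\<And>x. \<lbrakk>x \<in> carrier_vec n; x \<noteq> 0\<^sub>v n; \<And>f. f \<in> F \<Longrightarrow> f \<bullet> x = 0\<rbrakk>
      \<Longrightarrow> x \<bullet> (A *\<^sub>v x) < d * (x \<bullet> x)"
  shows "n \<le> card F + size {#e \<in># proots (char_poly A). e \<in> {0..<d}#}"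
proof -
  obtain P f where P: "P \<in> carrier_mat n n" and PtP: "transpose_mat P * P = 1\<^sub>m n"
    and AP: "A = P * mat_diag n f * transpose_mat P"
    using real_symmetric_spectral_decomposition[OF A sym] .
  have Pt: "transpose_mat P \<in> carrier_mat n n" using P by simp
  have PPt: "P * transpose_mat P = 1\<^sub>m n"
    using mat_mult_left_right_inverse[OF Pt P PtP] .
  have D: "mat_diag n f \<in> carrier_mat n n" by simp
  \<comment> \<open>Similarity to a diagonal matrix identifies the eigenvalues, with multiplicity,
    as the values \<open>f i\<close>.\<close>
  have "similar_mat A (mat_diag n f)"
    using A P Pt D PtP PPt AP by (intro similar_matI[of _ _ P "transpose_mat P" n]) auto
  then have "char_poly A = char_poly (mat_diag n f)" by (rule char_poly_similar)
  also have "\<dots> = (\<Prod>a\<leftarrow>diag_mat (mat_diag n f). [:- a, 1:])"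
    by (rule char_poly_upper_triangular[OF D]) (auto simp: mat_diag_def)
  also have "diag_mat (mat_diag n f) = map f [0..<n]"
    by (auto simp: diag_mat_def mat_diag_def)
  finally have roots: "proots (char_poly A) = mset (map f [0..<n])"
    by (simp only: proots_prod_list_linear)
  have form: "x \<bullet> (A *\<^sub>v x) = (\<Sum>i<n. f i * (col P i \<bullet> x)\<^sup>2)"
    and norm: "x \<bullet> x = (\<Sum>i<n. (col P i \<bullet> x)\<^sup>2)" if x: "x \<in> carrier_vec n" for x
  proof -
    \<comment> \<open>The coordinates of \<open>x\<close> in the orthonormal eigenbasis formed by
      the columns of \<open>P\<close>.\<close>
    define y where "y = transpose_mat P *\<^sub>v x"
    have y: "y \<in> carrier_vec n" using Pt x by (simp add: y_def)
    have yi: "y $ i = col P i \<bullet> x" if "i < n" for i using that P by (simp add: y_def)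
    have "A *\<^sub>v x = P *\<^sub>v (mat_diag n f *\<^sub>v y)"
      unfolding AP y_def using P D Pt x by (simp add: assoc_mult_mat_vec[of _ n n _ n])
    then have "x \<bullet> (A *\<^sub>v x) = y \<bullet> (mat_diag n f *\<^sub>v y)"
      using transpose_vec_mult_scalar[OF P _ x, of "mat_diag n f *\<^sub>v y"]
        mult_mat_vec_carrier[OF D y] by (simp add: y_def)
    also have "\<dots> = (\<Sum>i<n. y $ i * (f i * y $ i))"
    proof -
      have "(mat_diag n f *\<^sub>v y) $ i = f i * y $ i" if "i < n" for i
        using that y by (simp add: mat_diag_def scalar_prod_def if_distrib[of "\<lambda>a. a * _"] cong: if_cong)
      then show ?thesis by (simp add: scalar_prod_def mat_diag_def lessThan_atLeast0)
    qed
    finally show "x \<bullet> (A *\<^sub>v x) = (\<Sum>i<n. f i * (col P i \<bullet> x)\<^sup>2)"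
      by (simp add: yi power2_eq_square algebra_simps)
    have "x = P *\<^sub>v y" unfolding y_def using P Pt x PPt by (simp add: assoc_mult_mat_vec[of _ n n _ n, symmetric])
    then have "x \<bullet> x = y \<bullet> y"
      using transpose_vec_mult_scalar[OF P y x] by (simp add: y_def)
    also have "\<dots> = (\<Sum>i<n. y $ i * y $ i)" using y by (simp add: scalar_prod_def lessThan_atLeast0)
    finally show "x \<bullet> x = (\<Sum>i<n. (col P i \<bullet> x)\<^sup>2)" by (simp add: yi power2_eq_square)
  qed
  \<comment> \<open>Testing semidefiniteness on the \<open>i\<close>-th eigenvector isolates
    \<open>f i\<close>. Hence \<open>f i < d\<close> already means \<open>f i \<in> {0..<d}\<close>,
    which makes \<open>I\<close> below the right set to count.\<close>
  have f_nonneg: "0 \<le> f i" if i: "i < n" for i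
  proof -
    have "col P j \<bullet> col P i = (if j = i then 1 else 0)" if "j < n" for j
      using arg_cong[OF PtP, of "\<lambda>M. M $$ (j, i)"] i that P by simp
    then have "(\<Sum>j<n. f j * (col P j \<bullet> col P i)\<^sup>2) = (\<Sum>j<n. if j = i then f j else 0)"
      by (intro sum.cong) auto
    then show ?thesis using psd[of "col P i"] form[of "col P i"] P i by simp
  qed
  define I where "I = {i. i < n \<and> f i < d}"
  have fin: "finite I" by (simp add: I_def)
  have "size {#e \<in># proots (char_poly A). e \<in> {0..<d}#} = length (filter (\<lambda>i. f i \<in> {0..<d}) [0..<n])"
    unfolding roots mset_filter[symmetric] size_mset filter_map length_map by (simp only: o_def)
  also have "\<dots> = card I"
    unfolding length_filter_conv_card I_def using f_nonneg by (intro arg_cong[of _ _ card]) auto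
  finally have count: "size {#e \<in># proots (char_poly A). e \<in> {0..<d}#} = card I" .
  show ?thesis
  proof (rule ccontr)
    assume "\<not> ?thesis"
    then have lt: "card F + card I < n" unfolding count by simp
    \<comment> \<open>With too few constraints, some nonzero \<open>x\<close> satisfies those of
      \<open>F\<close> and is orthogonal to every eigenvector with eigenvalue below
      \<open>d\<close>. Its Rayleigh quotient is then both less than \<open>d\<close> and at least
      \<open>d\<close>.\<close>
    let ?G = "F \<union> col P ` I"
    have "card ?G \<le> card F + card (col P ` I)" by (rule card_Un_le)
    also have "\<dots> \<le> card F + card I" using fin by (simp add: card_image_le)
    finally have "card ?G < n" using lt by simp
    moreover have "?G \<subseteq> carrier_vec n" using F P by (auto simp: I_def)
    ultimately obtain x where x: "x \<in> carrier_vec n" "x \<noteq> 0\<^sub>v n" and orth: "\<And>g. g \<in> ?G \<Longrightarrow> g \<bullet> x = 0"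
      using exists_vec_orthogonal_to_few[of ?G n] F fin by auto
    have "d * (x \<bullet> x) = (\<Sum>i<n. d * (col P i \<bullet> x)\<^sup>2)" by (simp add: norm[OF x(1)] sum_distrib_left)
    also have "\<dots> \<le> (\<Sum>i<n. f i * (col P i \<bullet> x)\<^sup>2)"
    proof (rule sum_mono)
      fix i assume "i \<in> {..<n}"
      then show "d * (col P i \<bullet> x)\<^sup>2 \<le> f i * (col P i \<bullet> x)\<^sup>2"
        using orth[of "col P i"] by (cases "i \<in> I") (auto simp: I_def mult_right_mono)
    qed
    also have "\<dots> = x \<bullet> (A *\<^sub>v x)" by (simp add: form[OF x(1)])
    also have "\<dots> < d * (x \<bullet> x)" using less[OF x] orth by auto
    finally show False by simp
  qed
qed

subsection \<open>The Laplacian as a quadratic form\<close>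

definition neighbours :: "('a, 'b) pre_digraph \<Rightarrow> 'a \<Rightarrow> 'a set" where
  "neighbours G v = {w. (v, w) \<in> arcs_ends G}"

text \<open>Written row by row, as the product with the Laplacian matrix produces it; the two
  orientations of an edge together contribute \<open>(g v - g w)\<^sup>2\<close>.\<close>

definition laplacian_form :: "('a, 'b) pre_digraph \<Rightarrow> ('a \<Rightarrow> real) \<Rightarrow> real" where
  "laplacian_form G g = (\<Sum>v\<in>verts G. \<Sum>w\<in>neighbours G v. g v * (g v - g w))"

context graph
begin

lemma neighbours_subset: "neighbours G v \<subseteq> verts G"
  by (auto simp: neighbours_def)

lemma finite_neighbours [simp]: "finite (neighbours G v)"
  using finite_subset[OF neighbours_subset finite_verts] .

lemma neighbours_sym: "w \<in> neighbours G v \<longleftrightarrow> v \<in> neighbours G w"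
  using arcs_ends_symmetric sym_arcs by (auto simp: neighbours_def)

lemma not_self_neighbour: "v \<notin> neighbours G v"
  using adj_not_same by (auto simp: neighbours_def)

lemma out_degree_eq_card_neighbours: "out_degree G v = card (neighbours G v)"
proof -
  have "inj_on (head G) (out_arcs G v)"
    by (rule inj_onI) (auto intro: no_multi_arcs simp: arc_to_ends_def)
  moreover have "head G ` out_arcs G v = neighbours G v"
    by (auto simp: neighbours_def arcs_ends_conv out_arcs_def image_iff)
  ultimately show ?thesis unfolding out_degree_def by (metis card_image)
qed

text \<open>Adding the form to its copy with the endpoints exchanged exhibits twice the form as a
  sum of squares.\<close>

lemma laplacian_form_nonneg: "0 \<le> laplacian_form G g"
proof -
  let ?V = "verts G"
  \<comment> \<open>The indicator \<open>k\<close> lets both sums range over all vertices, so that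
    they can be swapped.\<close>
  define k :: "'a \<Rightarrow> 'a \<Rightarrow> real" where "k v w = (if w \<in> neighbours G v then 1 else 0)" for v w
  have eq: "laplacian_form G g = (\<Sum>v\<in>?V. \<Sum>w\<in>?V. k v w * (g v * (g v - g w)))"
    unfolding laplacian_form_def
  proof (rule sum.cong[OF refl])
    fix v
    have "(\<Sum>w\<in>neighbours G v. g v * (g v - g w)) = (\<Sum>w\<in>?V. if w \<in> neighbours G v then g v * (g v - g w) else 0)"
      using neighbours_subset[of v] by (simp add: sum.inter_restrict[symmetric] Int_absorb1)
    also have "\<dots> = (\<Sum>w\<in>?V. k v w * (g v * (g v - g w)))"
      by (intro sum.cong) (auto simp: k_def)
    finally show "(\<Sum>w\<in>neighbours G v. g v * (g v - g w)) = (\<Sum>w\<in>?V. k v w * (g v * (g v - g w)))" .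
  qed
  also have "\<dots> = (\<Sum>w\<in>?V. \<Sum>v\<in>?V. k v w * (g v * (g v - g w)))" by (rule sum.swap)
  also have "\<dots> = (\<Sum>v\<in>?V. \<Sum>w\<in>?V. k v w * (g w * (g w - g v)))"
    by (intro sum.cong) (auto simp: k_def neighbours_sym)
  finally have "2 * laplacian_form G g = (\<Sum>v\<in>?V. \<Sum>w\<in>?V. k v w * (g v * (g v - g w)))
      + (\<Sum>v\<in>?V. \<Sum>w\<in>?V. k v w * (g w * (g w - g v)))" using eq by simp
  also have "\<dots> = (\<Sum>v\<in>?V. \<Sum>w\<in>?V. k v w * (g v - g w)\<^sup>2)"
    unfolding sum.distrib[symmetric] by (intro sum.cong) (auto simp: power2_eq_square algebra_simps)
  also have "\<dots> \<ge> 0" by (intro sum_nonneg) (auto simp: k_def)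
  finally show ?thesis by simp
qed

abbreviation vert_enum :: "nat \<Rightarrow> 'a" where
  "vert_enum i \<equiv> vert_list G ! i"

lemma bij_betw_vert_enum: "bij_betw vert_enum {..<card (verts G)} (verts G)"
  using vert_list[OF finite_verts] by (intro bij_betw_nth) auto

lemma vert_enum_in_verts: "i < card (verts G) \<Longrightarrow> vert_enum i \<in> verts G"
  using bij_betw_vert_enum by (auto simp: bij_betw_def)

lemma vert_enum_eq_iff:
  "i < card (verts G) \<Longrightarrow> j < card (verts G) \<Longrightarrow> vert_enum i = vert_enum j \<longleftrightarrow> i = j"
  using bij_betw_vert_enum by (auto simp: bij_betw_def inj_on_def)

lemma sum_vert_enum: "(\<Sum>i<card (verts G). h (vert_enum i)) = (\<Sum>v\<in>verts G. h v)"
  by (rule sum.reindex_bij_betw[OF bij_betw_vert_enum])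

lemma laplacian_matrix_carrier:
  "laplacian_matrix G \<in> carrier_mat (card (verts G)) (card (verts G))"
  by (simp add: laplacian_matrix_def degree_matrix_def adjacency_matrix_def Let_def minus_carrier_mat)

lemma laplacian_matrix_index:
  assumes "i < card (verts G)" "j < card (verts G)"
  shows "laplacian_matrix G $$ (i, j) = (if i = j then real (card (neighbours G (vert_enum i))) else 0)
    - (if vert_enum j \<in> neighbours G (vert_enum i) then 1 else 0)"
  using assms by (simp add: laplacian_matrix_def degree_matrix_def adjacency_matrix_def Let_def
      out_degree_eq_card_neighbours neighbours_def)

lemma transpose_laplacian_matrix: "transpose_mat (laplacian_matrix G) = laplacian_matrix G"
proof (rule eq_matI)
  fix i j
  assume "i < dim_row (laplacian_matrix G)" "j < dim_col (laplacian_matrix G)"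
  then have "i < card (verts G)" "j < card (verts G)" using laplacian_matrix_carrier by auto
  then show "transpose_mat (laplacian_matrix G) $$ (i, j) = laplacian_matrix G $$ (i, j)"
    using laplacian_matrix_carrier
    by (auto simp: laplacian_matrix_index neighbours_sym[of "vert_enum i" "vert_enum j"])
qed (use laplacian_matrix_carrier in auto)

lemma laplacian_matrix_form:
  "vec (card (verts G)) (\<lambda>i. g (vert_enum i)) \<bullet>
     (laplacian_matrix G *\<^sub>v vec (card (verts G)) (\<lambda>i. g (vert_enum i))) = laplacian_form G g"
proof -
  let ?n = "card (verts G)" and ?x = "vec (card (verts G)) (\<lambda>i. g (vert_enum i))"
  have row: "(laplacian_matrix G *\<^sub>v ?x) $ i = (\<Sum>w\<in>neighbours G (vert_enum i). g (vert_enum i) - g w)"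
    if i: "i < ?n" for i
  proof -
    let ?v = "vert_enum i"
    have "(laplacian_matrix G *\<^sub>v ?x) $ i = (\<Sum>j<?n. laplacian_matrix G $$ (i, j) * g (vert_enum j))"
      using i laplacian_matrix_carrier by (auto simp: scalar_prod_def lessThan_atLeast0 intro!: sum.cong)
    also have "\<dots> = (\<Sum>j<?n. (\<lambda>w. (if w = ?v then real (card (neighbours G ?v)) * g w else 0)
        - (if w \<in> neighbours G ?v then g w else 0)) (vert_enum j))"
      using i by (intro sum.cong) (auto simp: laplacian_matrix_index vert_enum_eq_iff algebra_simps)
    also have "\<dots> = (\<Sum>w\<in>verts G. (if w = ?v then real (card (neighbours G ?v)) * g w else 0)
        - (if w \<in> neighbours G ?v then g w else 0))"
      by (rule sum_vert_enum)
    also have "\<dots> = real (card (neighbours G ?v)) * g ?v - (\<Sum>w\<in>neighbours G ?v. g w)"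
      using neighbours_subset[of ?v] vert_enum_in_verts[OF i]
      by (simp add: sum_subtractf sum.inter_restrict[symmetric] Int_absorb1)
    also have "\<dots> = (\<Sum>w\<in>neighbours G ?v. g ?v - g w)" by (simp add: sum_subtractf)
    finally show ?thesis .
  qed
  have "?x \<bullet> (laplacian_matrix G *\<^sub>v ?x)
      = (\<Sum>i<?n. (\<lambda>v. \<Sum>w\<in>neighbours G v. g v * (g v - g w)) (vert_enum i))"
    using laplacian_matrix_carrier row
    by (auto simp: scalar_prod_def lessThan_atLeast0 sum_distrib_left intro!: sum.cong)
  also have "\<dots> = laplacian_form G g" unfolding laplacian_form_def by (rule sum_vert_enum)
  finally show ?thesis .
qed

text \<open>The eigenvalue bound restated for functions on the vertices, so that later arguments are
  free of the enumeration. \<open>F\<close> holds the coefficient functions of the linear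
  constraints.\<close>

lemma laplacian_count_ge_codim:
  fixes F :: "('a \<Rightarrow> real) set"
  assumes F: "finite F"
    and less: "\<And>g. \<lbrakk>\<exists>v\<in>verts G. g v \<noteq> 0; \<And>\<phi>. \<phi> \<in> F \<Longrightarrow> (\<Sum>v\<in>verts G. \<phi> v * g v) = 0\<rbrakk>
      \<Longrightarrow> laplacian_form G g < d * (\<Sum>v\<in>verts G. (g v)\<^sup>2)"
  shows "card (verts G) \<le> card F + laplacian_count G {0..<d}"
proof -
  let ?n = "card (verts G)"
  let ?vec = "\<lambda>g :: 'a \<Rightarrow> real. vec ?n (\<lambda>i. g (vert_enum i))"
  have dot: "?vec g \<bullet> ?vec h = (\<Sum>v\<in>verts G. g v * h v)" for g h
    using sum_vert_enum[of "\<lambda>v. g v * h v"] by (simp add: scalar_prod_def lessThan_atLeast0)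
  have ex: "\<exists>g. x = ?vec g" if "x \<in> carrier_vec ?n" for x
  proof (intro exI eq_vecI)
    let ?g = "\<lambda>v. x $ (the_inv_into {..<?n} vert_enum v)"
    show "x $ i = ?vec ?g $ i" if "i < dim_vec (?vec ?g)" for i
      using that bij_betw_vert_enum by (simp add: the_inv_into_f_f bij_betw_def)
  qed (use that in simp)
  have "?n \<le> card (?vec ` F) + size {#e \<in># proots (char_poly (laplacian_matrix G)). e \<in> {0..<d}#}"
  proof (rule eigenvalue_count_ge_codim[OF laplacian_matrix_carrier transpose_laplacian_matrix])
    show "0 \<le> x \<bullet> (laplacian_matrix G *\<^sub>v x)" if "x \<in> carrier_vec ?n" for x
      using ex[OF that] by (auto simp: laplacian_matrix_form laplacian_form_nonneg)
  next
    fix x :: "real vec"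
    assume x: "x \<in> carrier_vec ?n" "x \<noteq> 0\<^sub>v ?n" and orth: "\<And>f. f \<in> ?vec ` F \<Longrightarrow> f \<bullet> x = 0"
    obtain g where g: "x = ?vec g" using ex[OF x(1)] by blast
    obtain i where "i < ?n" "g (vert_enum i) \<noteq> 0" using x(2) g by (auto simp: vec_eq_iff)
    then have "\<exists>v\<in>verts G. g v \<noteq> 0" using vert_enum_in_verts by blast
    then have "laplacian_form G g < d * (\<Sum>v\<in>verts G. (g v)\<^sup>2)"
      using orth by (intro less) (auto simp: g dot[symmetric])
    then show "x \<bullet> (laplacian_matrix G *\<^sub>v x) < d * (x \<bullet> x)"
      unfolding g laplacian_matrix_form dot by (simp add: power2_eq_square)
  qed (use F in auto)
  also have "\<dots> \<le> card F + laplacian_count G {0..<d}"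
    using card_image_le[OF F] by (simp add: laplacian_count_def laplacian_eigenvalues_def)
  finally show ?thesis .
qed

end

subsection \<open>Paths in forests and trees\<close>

text \<open>Links walks as vertex lists, on which the arguments below operate, with the arc lists in
  which \<open>cycle\<close> and \<open>apath\<close> are formulated.\<close>

lemma (in wf_digraph) vwalk_imp_awalk:
  assumes "vwalk xs G"
  shows "\<exists>p. awalk (hd xs) p (last xs) \<and> awalk_verts (hd xs) p = xs"
  using assms
proof (induction rule: vwalk_induct)
  case (Base u)
  then show ?case by (intro exI[of _ "[]"]) (simp add: awalk_Nil_iff)
next
  case (Cons u v es)
  then obtain p where p: "awalk v p (last (v # es))" "awalk_verts v p = v # es" by auto
  obtain e where e: "e \<in> arcs G" "tail G e = u" "head G e = v"
    using Cons.hyps by auto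
  then have "awalk u (e # p) (last (v # es))" using p by (simp add: awalk_Cons_iff)
  moreover have "awalk_verts u (e # p) = u # v # es" using e p by simp
  ultimately show ?case by (intro exI[of _ "e # p"]) simp
qed

locale undirected_forest = graph G for G :: "('a, 'b) pre_digraph" +
  assumes cycle_short: "cycle p \<Longrightarrow> length p < 3"
begin

lemma adj_sym: "(u, v) \<in> arcs_ends G \<Longrightarrow> (v, u) \<in> arcs_ends G"
  using arcs_ends_symmetric[OF sym_arcs] .

lemma vpath_rev: "vpath xs G \<Longrightarrow> vpath (rev xs) G"
  using vwalk_rev_ex[OF sym_arcs] by (auto simp: vpath_def)

lemma vpath_Cons_Cons: "vpath (x # y # xs) G \<longleftrightarrow> (x, y) \<in> arcs_ends G \<and> x \<notin> set (y # xs) \<and> vpath (y # xs) G"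
  by (auto simp: vpath_def)

lemma vpath_prefix: "vpath (xs @ ys) G \<Longrightarrow> xs \<noteq> [] \<Longrightarrow> vpath xs G"
  by (auto simp: vpath_def dest: vwalkI_append_l)

text \<open>An arc from the last vertex back to the first would close the path to a cycle of length
  at least 3.\<close>

lemma no_closed_vpath:
  assumes xs: "vpath xs G" "length xs \<ge> 3"
  shows "(last xs, hd xs) \<notin> arcs_ends G"
proof
  assume "(last xs, hd xs) \<in> arcs_ends G"
  \<comment> \<open>Starting at \<open>last xs\<close> makes the tail of the vertex list equal to
    \<open>xs\<close>, whose distinctness is what \<open>cycle\<close> demands.\<close>
  then have "vwalk (last xs # xs) G" using xs by (cases xs) (auto simp: vpath_def)
  from vwalk_imp_awalk[OF this] obtain p
    where p: "awalk (last xs) p (last xs)" "awalk_verts (last xs) p = last xs # xs"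
    using xs by auto
  have "length p = length xs" using p(2) length_awalk_verts[of "last xs" p] by simp
  moreover have "cycle p" unfolding cycle_def
    using p xs calculation by (intro exI[of _ "last xs"]) (auto simp: vpath_def)
  ultimately show False using cycle_short[of p] xs by simp
qed

text \<open>If \<open>z\<close> occurred later on the path, the arc from \<open>z\<close> to
  \<open>x\<close> would close the segment from \<open>x\<close> to \<open>z\<close>; excluding
  \<open>y\<close> gives that segment at least three vertices.\<close>

lemma vpath_extend:
  assumes xs: "vpath (x # y # xs) G" and zx: "(z, x) \<in> arcs_ends G" and zy: "z \<noteq> y"
  shows "vpath (z # x # y # xs) G"
proof -
  have "z \<noteq> x" using zx adj_not_same by blast
  moreover have "z \<notin> set xs"
  proof
    assume "z \<in> set xs"
    then obtain as bs where "xs = as @ z # bs" by (auto simp: in_set_conv_decomp)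
    then have "vpath (x # y # as @ [z]) G" using vpath_prefix[of "x # y # as @ [z]" bs] xs by simp
    then show False using no_closed_vpath[of "x # y # as @ [z]"] zx by simp
  qed
  ultimately show ?thesis using xs zx zy by (simp add: vpath_Cons_Cons)
qed

text \<open>The first branch is attached to the second one vertex at a time, moving away from
  \<open>c\<close>; \<open>vpath_extend\<close> then only asks that each new vertex differ from the
  one two places further on.\<close>

lemma vpath_join:
  assumes "vpath (c # a # as) G" "vpath (c # b # bs) G" "a \<noteq> b"
  shows "vpath (rev as @ a # c # b # bs) G"
  using assms(1)
proof (induction as rule: rev_induct)
  case Nil
  then show ?case using vpath_extend[OF assms(2), of a] assms(3)
    by (simp add: vpath_Cons_Cons adj_sym)
next
  case (snoc z as)
  have path: "vpath (c # a # as) G"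
    using snoc.prems vpath_prefix[of "c # a # as" "[z]"] by simp
  have IH: "vpath (rev as @ a # c # b # bs) G" by (rule snoc.IH[OF path])
  have z: "vpath (z # rev as @ [a, c]) G" using vpath_rev[OF snoc.prems] by simp
  show ?case
  proof (cases "rev as")
    case Nil
    then show ?thesis using z IH vpath_extend[of a c "b # bs" z] by (simp add: vpath_Cons_Cons)
  next
    case (Cons w ws)
    \<comment> \<open>\<open>s\<close> follows \<open>w\<close> on the joined path and still lies on
      the first branch, so the new vertex \<open>z\<close> differs from it.\<close>
    obtain s ss where s: "ws @ a # c # b # bs = s # ss" "s \<in> set (ws @ [a])"
      by (cases ws) auto
    have "vpath (w # s # ss) G" using IH Cons s by simp
    moreover have "(z, w) \<in> arcs_ends G" "z \<noteq> s" using z Cons s by (auto simp: vpath_Cons_Cons)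
    ultimately have "vpath (z # w # s # ss) G" by (rule vpath_extend)
    then show ?thesis using Cons s by simp
  qed
qed

text \<open>Two paths that diverge after a common vertex join to a single path by
  \<open>vpath_join\<close>, so their remainders are disjoint and cannot share an endpoint.\<close>

lemma vpath_unique:
  assumes "vpath xs G" "vpath ys G" "hd xs = hd ys" "last xs = last ys"
  shows "xs = ys"
  using assms
proof (induction xs arbitrary: ys)
  case Nil
  then show ?case by (auto simp: vpath_def)
next
  case (Cons x xs)
  obtain ys' where ys: "ys = x # ys'"
    using Cons.prems by (cases ys) (auto simp: vpath_def)
  show ?case
  proof (cases "xs = [] \<or> ys' = []")
    case True
    then show ?thesis
      using Cons.prems ys by (cases xs rule: rev_cases; cases ys' rule: rev_cases) (auto simp: vpath_def)
  next
    case False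
    then obtain a as b bs where ab: "xs = a # as" "ys' = b # bs" by (meson neq_Nil_conv)
    have "a = b"
    proof (rule ccontr)
      assume "a \<noteq> b"
      then have "vpath (rev as @ a # x # b # bs) G"
        using vpath_join Cons.prems(1,2) ys ab by simp
      then have "set (a # as) \<inter> set (b # bs) = {}" by (auto simp: vpath_def)
      moreover have "last (a # as) = last (b # bs)" using Cons.prems(4) ys ab by simp
      ultimately show False using last_in_set[of "a # as"] last_in_set[of "b # bs"]
        by (metis disjoint_iff list.distinct(1))
    qed
    then show ?thesis using Cons.IH[of ys'] Cons.prems ys ab by (auto simp: vpath_Cons_Cons)
  qed
qed

text \<open>Uniqueness of paths leaves a single length for the minimum to range over. The successor
  passes from arcs to vertices.\<close>

lemma vert_dist_vpath:
  assumes xs: "vpath xs G"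
  shows "Suc (vert_dist G (hd xs) (last xs)) = length xs"
proof -
  have len: "Suc (length p) = length xs" if "apath (hd xs) p (last xs)" for p
  proof -
    let ?ys = "awalk_verts (hd xs) p"
    have "awalk (hd xs) p (last xs)" "distinct ?ys" using that by (auto simp: apath_def)
    then have "vpath ?ys G" "hd ?ys = hd xs" "last ?ys = last xs"
      by (auto simp: vpath_def intro: awalk_imp_vwalk)
    then have "?ys = xs" using vpath_unique[of ?ys xs] xs by simp
    then show ?thesis using length_awalk_verts[of "hd xs" p] by simp
  qed
  obtain p where p: "apath (hd xs) p (last xs)"
    using vwalk_imp_awalk[of xs] xs unfolding apath_def vpath_def by metis
  have "vert_dist G (hd xs) (last xs) = length p"
    unfolding vert_dist_def
  proof (rule Least_equality)
    show "\<exists>q. apath (hd xs) q (last xs) \<and> length q = length p" using p by blast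
  next
    fix k assume "\<exists>q. apath (hd xs) q (last xs) \<and> length q = k"
    then obtain q where "apath (hd xs) q (last xs)" "length q = k" by blast
    then show "length p \<le> k" using len[of q] len[OF p] by simp
  qed
  then show ?thesis using len[OF p] by simp
qed

end

locale undirected_tree_graph = undirected_forest +
  assumes connected: "Digraph_Component.connected G"
begin

lemma vpath_exists:
  assumes "u \<in> verts G" "v \<in> verts G"
  obtains xs where "vpath xs G" "hd xs = u" "last xs = v"
proof -
  have "strongly_connected G"
    using symmetric_connected_imp_strongly_connected[OF sym_arcs connected] .
  then have "u \<rightarrow>\<^sup>*\<^bsub>G\<^esub> v" using assms by auto
  then show ?thesis using that by (auto simp: reachable_vpath_conv)
qed

lemma length_vpath_le_diameter:
  assumes "vpath xs G"
  shows "length xs \<le> Suc (diameter G)"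
proof -
  have "finite {vert_dist G u v | u v. u \<in> verts G \<and> v \<in> verts G}"
    by (rule finite_subset[of _ "(\<lambda>(u, v). vert_dist G u v) ` (verts G \<times> verts G)"]) auto
  moreover have "hd xs \<in> verts G" "last xs \<in> verts G"
    using assms by (auto simp: vpath_def vwalk_def)
  ultimately have "vert_dist G (hd xs) (last xs) \<le> diameter G"
    unfolding diameter_def by (intro Max_ge) auto
  then show ?thesis using vert_dist_vpath[OF assms] by simp
qed

lemma diameter_vpath_exists:
  obtains xs where "vpath xs G" "length xs = Suc (diameter G)"
proof -
  let ?S = "{vert_dist G u v | u v. u \<in> verts G \<and> v \<in> verts G}"
  have "finite ?S"
    by (rule finite_subset[of _ "(\<lambda>(u, v). vert_dist G u v) ` (verts G \<times> verts G)"]) auto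
  moreover obtain r where "r \<in> verts G"
    using connected by (auto simp: connected_def strongly_connected_def)
  then have "vert_dist G r r \<in> ?S" by blast
  then have "?S \<noteq> {}" by blast
  ultimately have "diameter G \<in> ?S" unfolding diameter_def by (rule Max_in)
  then obtain u v where "u \<in> verts G" "v \<in> verts G" "diameter G = vert_dist G u v" by auto
  moreover obtain xs where "vpath xs G" "hd xs = u" "last xs = v"
    using vpath_exists[OF \<open>u \<in> verts G\<close> \<open>v \<in> verts G\<close>] .
  ultimately show ?thesis using that[of xs] vert_dist_vpath[of xs] by simp
qed

end

subsection \<open>Trees of diameter 4\<close>

definition leaves :: "('a, 'b) pre_digraph \<Rightarrow> 'a set" where
  "leaves G = {v \<in> verts G. card (neighbours G v) = 1}"

context undirected_forest
begin

lemma no_triangle: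
  assumes "v \<in> neighbours G u" "w \<in> neighbours G u"
  shows "w \<notin> neighbours G v"
proof
  assume w: "w \<in> neighbours G v"
  have "u \<noteq> v" "u \<noteq> w" "v \<noteq> w" using assms w not_self_neighbour by auto
  then have "vpath [u, v, w] G"
    using assms w by (auto simp: vpath_def neighbours_def)
  then show False using no_closed_vpath[of "[u, v, w]"] assms(2) adj_sym by (auto simp: neighbours_def)
qed

end

context undirected_tree_graph
begin

text \<open>\<open>c\<close> is the middle of a path with five vertices. A path from
  \<open>c\<close> to a non-leaf not adjacent to \<open>c\<close> could be prolonged by one more
  vertex; joined to an arm leaving \<open>c\<close> in another direction, it would have at least six
  vertices.\<close>

lemma center_of_diameter_4:
  assumes diam: "diameter G = 4"
  obtains c a b where "c \<in> verts G" "a \<noteq> b" "a \<in> neighbours G c" "b \<in> neighbours G c"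
    "\<And>v. \<lbrakk>v \<in> verts G; v \<noteq> c; v \<notin> leaves G\<rbrakk> \<Longrightarrow> v \<in> neighbours G c"
proof -
  obtain xs where xs: "vpath xs G" "length xs = Suc 4"
    using diameter_vpath_exists diam by metis
  then obtain u a c b w where "xs = [u, a, c, b, w]"
    by (auto simp: numeral_eq_Suc length_Suc_conv)
  with xs have path: "vpath [u, a, c, b, w] G" by simp
  have right: "vpath (c # b # [w]) G" using path by (auto simp: vpath_Cons_Cons)
  have left: "vpath (c # a # [u]) G"
    using vpath_rev[OF path] by (auto simp: vpath_Cons_Cons)
  have ab: "a \<noteq> b" using path by (auto simp: vpath_Cons_Cons)
  have "v \<in> neighbours G c" if v: "v \<in> verts G" "v \<noteq> c" "v \<notin> leaves G" for v
  proof (rule ccontr)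
    assume nadj: "v \<notin> neighbours G c"
    have "c \<in> verts G" using path by (auto simp: vpath_def vwalk_def)
    then obtain ps where ps: "vpath ps G" "hd ps = c" "last ps = v"
      using vpath_exists[of c v] v(1) by blast
    then have "vpath (rev ps) G" "hd (rev ps) = v" "last (rev ps) = c"
      using vpath_rev by (auto simp: hd_rev last_rev)
    then obtain p qs where pqs: "rev ps = v # p # qs"
      using v(2) by (cases "rev ps"; cases "tl (rev ps)") (auto simp: vpath_def)
    then have vp: "vpath (v # p # qs) G" using \<open>vpath (rev ps) G\<close> by simp
    then have "p \<in> neighbours G v" by (simp add: vpath_Cons_Cons neighbours_def)
    \<comment> \<open>Not being a leaf, \<open>v\<close> has a neighbour besides \<open>p\<close>,
      through which the path from \<open>c\<close> continues.\<close>
    moreover have "neighbours G v \<noteq> {p}" using v by (auto simp: leaves_def)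
    ultimately obtain z where z: "z \<in> neighbours G v" "z \<noteq> p" by blast
    then have "vpath (z # v # p # qs) G"
      using vpath_extend[OF vp, of z] adj_sym by (simp add: neighbours_def)
    then have long: "vpath (rev qs @ [p, v, z]) G" using vpath_rev[of "z # v # p # qs"] by simp
    have "qs \<noteq> []"
      using pqs ps(2) nadj vp adj_sym by (auto simp: vpath_Cons_Cons neighbours_def)
    moreover have "ps = rev qs @ [p, v]" using pqs by (metis append.assoc append_Cons append_Nil rev.simps(2) rev_rev_ident)
    then have "hd (rev qs @ [p, v]) = c" using ps(2) by simp
    ultimately obtain y ys where ys: "rev qs @ [p, v, z] = c # y # ys" "length ys \<ge> 2"
      by (cases "rev qs"; cases "tl (rev qs)") auto
    have cy: "vpath (c # y # ys) G" using long ys by simp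
    \<comment> \<open>The two arms start with \<open>a\<close> and \<open>b\<close>, so at least one
      of them avoids \<open>y\<close>.\<close>
    obtain t r where "vpath (c # t # [r]) G" "t \<noteq> y"
      using left right ab by metis
    from vpath_join[OF this(1) cy this(2)] have "vpath (r # t # c # y # ys) G" by simp
    from length_vpath_le_diameter[OF this] show False using ys(2) diam by simp
  qed
  moreover have "c \<in> verts G" "a \<in> neighbours G c" "b \<in> neighbours G c"
    using left right by (auto simp: vpath_Cons_Cons neighbours_def)
  ultimately show ?thesis using that[of c a b] ab by blast
qed

text \<open>Two adjacent leaves have no further neighbours, so no path could lead from them to the
  non-leaf \<open>c\<close>.\<close>

lemma neighbour_of_leaf_not_leaf:
  assumes c: "c \<in> verts G" "c \<notin> leaves G"
    and l: "l \<in> leaves G" and l': "l' \<in> neighbours G l"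
  shows "l' \<notin> leaves G"
proof
  assume "l' \<in> leaves G"
  then have nl': "neighbours G l' = {l}"
    using l' neighbours_sym[of l l'] by (auto simp: leaves_def card_1_singleton_iff)
  have nl: "neighbours G l = {l'}" using l l' by (auto simp: leaves_def card_1_singleton_iff)
  obtain ps where ps: "vpath ps G" "hd ps = l" "last ps = c"
    using vpath_exists[of l c] l c by (auto simp: leaves_def)
  have "l \<noteq> c" using l c by auto
  then obtain p qs where "ps = l # p # qs"
    using ps by (cases ps; cases "tl ps") (auto simp: vpath_def)
  then have vp: "vpath (l # p # qs) G" "last (p # qs) = c" using ps by auto
  then have "p = l'" using nl by (auto simp: vpath_Cons_Cons neighbours_def)
  then have "qs \<noteq> []" using vp \<open>l' \<in> leaves G\<close> c by auto
  then obtain q rs where "qs = q # rs" by (cases qs) auto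
  then have "q \<in> neighbours G l'" "q \<noteq> l" using vp \<open>p = l'\<close> by (auto simp: vpath_Cons_Cons neighbours_def)
  then show False using nl' by simp
qed

text \<open>The constraints make \<open>g\<close> vanish off the leaves. As no two leaves are
  adjacent, the form is then the squared norm.\<close>

lemma laplacian_count_ge_card_leaves:
  assumes c: "c \<in> verts G" "c \<notin> leaves G" and d: "d > 1"
  shows "card (leaves G) \<le> laplacian_count G {0..<d}"
proof -
  let ?V = "verts G" and ?L = "leaves G"
  let ?F = "(\<lambda>u v. if v = u then 1 else 0 :: real) ` (?V - ?L)"
  have L: "?L \<subseteq> ?V" by (auto simp: leaves_def)
  have "card ?V \<le> card ?F + laplacian_count G {0..<d}"
  proof (rule laplacian_count_ge_codim)
    fix g :: "'a \<Rightarrow> real"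
    assume nz: "\<exists>v\<in>?V. g v \<noteq> 0" and orth: "\<And>\<phi>. \<phi> \<in> ?F \<Longrightarrow> (\<Sum>v\<in>?V. \<phi> v * g v) = 0"
    have g0: "g u = 0" if "u \<in> ?V - ?L" for u
      using orth[OF imageI[OF that]] that by (simp add: if_distrib[of "\<lambda>a. a * _"] cong: if_cong)
    have inner: "(\<Sum>w\<in>neighbours G v. g v * (g v - g w)) = (g v)\<^sup>2" if v: "v \<in> ?V" for v
    proof (cases "v \<in> ?L")
      case True
      then obtain w where w: "neighbours G v = {w}" by (auto simp: leaves_def card_1_singleton_iff)
      then have "w \<in> ?V - ?L"
        using neighbour_of_leaf_not_leaf[OF c True, of w] neighbours_subset[of v] by auto
      then show ?thesis using w g0 by (simp add: power2_eq_square)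
    qed (use v g0 in simp)
    have "laplacian_form G g = (\<Sum>v\<in>?V. (g v)\<^sup>2)"
      unfolding laplacian_form_def using inner by simp
    moreover have "(\<Sum>v\<in>?V. (g v)\<^sup>2) > 0" using nz by (auto intro: sum_pos2)
    ultimately show "laplacian_form G g < d * (\<Sum>v\<in>?V. (g v)\<^sup>2)" using d by simp
  qed simp
  also have "card ?F \<le> card (?V - ?L)" by (intro card_image_le) simp
  also have "card (?V - ?L) = card ?V - card ?L" 
    using finite_subset[OF L finite_verts] L by (rule card_Diff_subset)
  finally show ?thesis using card_mono[OF finite_verts L] by simp
qed

end

section \<open>Subdivided stars\<close>

text \<open>
  \<open>a\<close>, \<open>b\<close>, \<open>y v\<close> are the values at the centre, at its neighbours and at the leaf attached to \<open>v\<close>.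
  Maximising \<open>(b - t)\<^sup>2 - d * t\<^sup>2\<close> over \<open>t\<close> gives \<open>(e + d) * b\<^sup>2\<close>, and then \<open>b = a / (1 + e)\<close>
  minimises \<open>(a - b)\<^sup>2 + e * b\<^sup>2\<close>.
\<close>

lemma spider_form_less:
  fixes d a :: real and y :: "'a \<Rightarrow> real"
  assumes N: "finite N" and r: "r = real (card N)" and d: "d > 1"
    and e: "e = d / (d - 1) - d" and re: "r * e < d * (1 + e)" and b: "b = a / (1 + e)" and e0: "e \<ge> 0"
    and nz: "a \<noteq> 0 \<or> (\<exists>v\<in>N. y v \<noteq> 0)"
  shows "r * (a - b)\<^sup>2 + (\<Sum>v\<in>N. (b - y v)\<^sup>2) < d * (a\<^sup>2 + r * b\<^sup>2 + (\<Sum>v\<in>N. (y v)\<^sup>2))"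
proof (cases "a = 0")
  case True
  \<comment> \<open>\<open>a = 0\<close> forces \<open>b = 0\<close>, so only the squares of the
    \<open>y v\<close> remain and \<open>d > 1\<close> decides.\<close>
  have "(\<Sum>v\<in>N. (y v)\<^sup>2) > 0" using nz True N by (auto intro: sum_pos2)
  then show ?thesis using True b d by simp
next
  case False
  have sq: "(b - t)\<^sup>2 \<le> d * t\<^sup>2 + (e + d) * b\<^sup>2" for t
  proof -
    \<comment> \<open>The maximiser is \<open>t = - k\<close>, so the slack is a multiple of
      \<open>(t + k)\<^sup>2\<close>.\<close>
    define k where "k = b / (d - 1)"
    have k: "b = (d - 1) * k" "(e + d) * b = d * k" using d by (simp_all add: k_def e)
    have "(e + d) * b\<^sup>2 = d * k * b" using k(2) by (simp add: power2_eq_square mult.assoc[symmetric])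
    moreover have "d * t\<^sup>2 + d * k * ((d - 1) * k) - ((d - 1) * k - t)\<^sup>2 = (d - 1) * (t + k)\<^sup>2"
      by (simp add: algebra_simps power2_eq_square)
    ultimately have "d * t\<^sup>2 + (e + d) * b\<^sup>2 - (b - t)\<^sup>2 = (d - 1) * (t + k)\<^sup>2"
      unfolding k(1)[symmetric] by simp
    also have "\<dots> \<ge> 0" using d by simp
    finally show ?thesis by simp
  qed
  have "(\<Sum>v\<in>N. (b - y v)\<^sup>2) \<le> (\<Sum>v\<in>N. d * (y v)\<^sup>2 + (e + d) * b\<^sup>2)"
    by (rule sum_mono) (rule sq)
  also have "\<dots> = d * (\<Sum>v\<in>N. (y v)\<^sup>2) + r * ((e + d) * b\<^sup>2)"
    by (simp add: sum.distrib sum_distrib_left r)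
  finally have 1: "(\<Sum>v\<in>N. (b - y v)\<^sup>2) \<le> d * (\<Sum>v\<in>N. (y v)\<^sup>2) + r * ((e + d) * b\<^sup>2)" .
  have ab: "a = b * (1 + e)" using b e0 by simp
  then have "b \<noteq> 0" using False by auto
  \<comment> \<open>Since \<open>a - b = e * b\<close>, both sides become multiples of
    \<open>(1 + e) * b\<^sup>2\<close>, and the comparison reduces to \<open>re\<close>.\<close>
  have "r * (a - b)\<^sup>2 + r * (e * b\<^sup>2) = (r * e) * ((1 + e) * b\<^sup>2)"
    unfolding ab by (simp add: algebra_simps power2_eq_square)
  also have "\<dots> < (d * (1 + e)) * ((1 + e) * b\<^sup>2)"
    using re e0 \<open>b \<noteq> 0\<close> by (intro mult_strict_right_mono) auto
  also have "\<dots> = d * a\<^sup>2" unfolding ab by (simp add: algebra_simps power2_eq_square)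
  finally show ?thesis using 1 by (simp add: algebra_simps)
qed

context graph
begin

text \<open>A star with every edge subdivided, \<open>f v\<close> being the leaf beyond
  \<open>v\<close>. Prescribing the optimal value \<open>g c / (1 + e)\<close> on \<open>N\<close>
  costs at most \<open>card N\<close> of the \<open>2 * card N + 1\<close> dimensions.\<close>

lemma laplacian_count_spider:
  fixes d :: real
  assumes c: "c \<notin> N" "c \<notin> f ` N" and fN: "inj_on f N" "N \<inter> f ` N = {}"
    and V: "verts G = insert c (N \<union> f ` N)"
    and nc: "neighbours G c = N" and nN: "\<And>v. v \<in> N \<Longrightarrow> neighbours G v = {c, f v}"
    and nf: "\<And>v. v \<in> N \<Longrightarrow> neighbours G (f v) = {v}"
    and N: "N \<noteq> {}" and d: "d = 2 - 2 / real (card (verts G))"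
  shows "Suc (card N) \<le> laplacian_count G {0..<d}"
proof -
  let ?V = "verts G"
  have finN: "finite N" using nc finite_neighbours by metis
  define r where "r = real (card N)"
  have r: "r \<ge> 1" using N finN by (simp add: r_def Suc_le_eq card_gt_0_iff)
  have sumV: "(\<Sum>v\<in>?V. h v) = h c + (\<Sum>v\<in>N. h v) + (\<Sum>v\<in>N. h (f v))" for h :: "'a \<Rightarrow> real"
    unfolding V using c fN finN by (simp add: sum.union_disjoint sum.reindex)
  have cardV: "card ?V = 2 * card N + 1"
    unfolding V using c fN finN by (simp add: card_Un_disjoint card_image)
  have dr: "d = 4 * r / (2 * r + 1)" unfolding d cardV using r by (simp add: r_def field_simps)
  define e where "e = d / (d - 1) - d"
  have d1: "d - 1 = (2 * r - 1) / (2 * r + 1)" using r by (simp add: dr field_simps)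
  have d_gt: "d > 1" using r by (simp add: dr field_simps)
  have er: "e = 8 * r / ((2 * r - 1) * (2 * r + 1))"
    unfolding e_def d1 dr using r by (simp add: divide_simps) (simp add: algebra_simps)
  have e0: "e \<ge> 0" unfolding er using r by simp
  have re: "r * e < d * (1 + e)"
  proof -
    define D where "D = (2 * r - 1) * (2 * r + 1)"
    have D: "D > 0" "D = 4 * r\<^sup>2 - 1"
      using r by (simp add: D_def) (simp add: D_def power2_eq_square algebra_simps)
    \<comment> \<open>This amounts to \<open>1 < 6 * r\<close>; it is what clearing denominators in
      \<open>r * e < d * (1 + e)\<close> leaves.\<close>
    have "2 * r * (2 * r + 1) < D + 8 * r" using r unfolding D(2) by (simp add: power2_eq_square algebra_simps)
    then have "(2 * r * (2 * r + 1)) * (4 * r) < (D + 8 * r) * (4 * r)" using r by (intro mult_strict_right_mono) auto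
    then have "8 * r * r * (2 * r + 1) < 4 * r * (D + 8 * r)" by (simp add: algebra_simps)
    then have "8 * r * r < 4 * r * (D + 8 * r) / (2 * r + 1)" using r by (simp add: pos_less_divide_eq)
    then have "8 * r * r / D < 4 * r * (D + 8 * r) / (2 * r + 1) / D"
      using D(1) by (rule divide_strict_right_mono)
    moreover have "r * e = 8 * r * r / D" by (simp add: er D_def)
    moreover have "1 + e = (D + 8 * r) / D" using D(1) by (simp add: er D_def[symmetric] add_divide_distrib)
    then have "d * (1 + e) = 4 * r * (D + 8 * r) / (2 * r + 1) / D" by (simp add: dr)
    ultimately show ?thesis by simp
  qed
  \<comment> \<open>Orthogonality to \<open>?\<phi> u\<close> says
    \<open>g u = g c / (1 + e)\<close>.\<close>
  let ?\<phi> = "\<lambda>u v. (if v = u then 1 else 0) - (if v = c then 1 / (1 + e) else 0)"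
  have "card ?V \<le> card (?\<phi> ` N) + laplacian_count G {0..<d}"
  proof (rule laplacian_count_ge_codim)
    fix g :: "'a \<Rightarrow> real"
    assume nz: "\<exists>v\<in>?V. g v \<noteq> 0" and orth: "\<And>\<phi>. \<phi> \<in> ?\<phi> ` N \<Longrightarrow> (\<Sum>v\<in>?V. \<phi> v * g v) = 0"
    define b where "b = g c / (1 + e)"
    have gN: "g u = b" if "u \<in> N" for u
    proof -
      have "(\<Sum>v\<in>?V. ?\<phi> u v * g v) = (\<Sum>v\<in>?V. (if v = u then g v else 0) - (if v = c then b else 0))"
        by (intro sum.cong) (auto simp: b_def algebra_simps)
      also have "\<dots> = g u - b"
      proof -
        have "u \<in> ?V" "c \<in> ?V" using that V by auto
        then show ?thesis by (simp add: sum_subtractf)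
      qed
      finally show ?thesis using orth[OF imageI[OF that]] by simp
    qed
    have "c \<noteq> f v" if "v \<in> N" for v using c that by auto
    \<comment> \<open>Grouped by centre, middle vertices and leaves; the two orientations of each
      edge then combine to a square.\<close>
    then have "laplacian_form G g = (\<Sum>w\<in>N. g c * (g c - g w))
        + (\<Sum>v\<in>N. g v * (g v - g c) + g v * (g v - g (f v))) + (\<Sum>v\<in>N. g (f v) * (g (f v) - g v))"
      unfolding laplacian_form_def sumV by (simp add: nc nN nf)
    also have "\<dots> = (\<Sum>v\<in>N. (g c - b)\<^sup>2 + (b - g (f v))\<^sup>2)"
      unfolding sum.distrib[symmetric] by (intro sum.cong) (auto simp: gN power2_eq_square algebra_simps)
    also have "\<dots> = r * (g c - b)\<^sup>2 + (\<Sum>v\<in>N. (b - g (f v))\<^sup>2)" by (simp add: sum.distrib r_def)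
    also have "\<dots> < d * ((g c)\<^sup>2 + r * b\<^sup>2 + (\<Sum>v\<in>N. (g (f v))\<^sup>2))"
    proof (rule spider_form_less[OF finN r_def d_gt e_def re b_def e0])
      \<comment> \<open>If \<open>g\<close> vanished at the centre and at all leaves, then
        \<open>b = 0\<close> and it would vanish on \<open>N\<close> too.\<close>
      show "g c \<noteq> 0 \<or> (\<exists>v\<in>N. g (f v) \<noteq> 0)" using nz gN unfolding V b_def by force
    qed
    also have "(g c)\<^sup>2 + r * b\<^sup>2 + (\<Sum>v\<in>N. (g (f v))\<^sup>2) = (\<Sum>v\<in>?V. (g v)\<^sup>2)"
      by (simp add: sumV gN r_def)
    finally show "laplacian_form G g < d * (\<Sum>v\<in>?V. (g v)\<^sup>2)" .
  qed (use finN in simp)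
  also have "card (?\<phi> ` N) \<le> card N" using finN by (rule card_image_le)
  finally show ?thesis using cardV by simp
qed

end

section \<open>Comparing the numbers of leaves and inner vertices\<close>

context undirected_tree_graph
begin

text \<open>Each inner vertex other than \<open>c\<close> has a leaf of its own, so
  \<open>card N \<le> card ?L\<close>. If this is strict, \<open>n \<le> 2 * card ?L\<close> and the
  leaves suffice; otherwise the tree is a subdivided star with
  \<open>n = 2 * card N + 1\<close>.\<close>

lemma laplacian_count_diameter_4:
  assumes diam: "diameter G = 4" and d: "d = 2 - 2 / real (card (verts G))"
  shows "card (verts G) \<le> 2 * laplacian_count G {0..<d}"
proof -
  let ?V = "verts G" and ?L = "leaves G"
  obtain c a b where c: "c \<in> ?V" and ab: "a \<noteq> b" "a \<in> neighbours G c" "b \<in> neighbours G c"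
    and inner: "\<And>v. \<lbrakk>v \<in> ?V; v \<noteq> c; v \<notin> ?L\<rbrakk> \<Longrightarrow> v \<in> neighbours G c"
    using center_of_diameter_4[OF diam] by blast
  have cL: "c \<notin> ?L" using ab by (auto simp: leaves_def card_1_singleton_iff)
  have LV: "?L \<subseteq> ?V" by (auto simp: leaves_def)
  have finL: "finite ?L" using finite_subset[OF LV finite_verts] .
  define N where "N = ?V - ?L - {c}"
  have finN: "finite N" by (simp add: N_def)
  have V: "?V = insert c (N \<union> ?L)" using c LV by (auto simp: N_def)
  have Nc: "v \<in> neighbours G c" "c \<in> neighbours G v" if "v \<in> N" for v
    using inner[of v] that neighbours_sym[of v c] by (auto simp: N_def)
  have "\<exists>l. l \<in> ?L \<and> l \<in> neighbours G v" if v: "v \<in> N" for v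
  proof -
    have "card (neighbours G v) \<noteq> 1" using v by (simp add: N_def leaves_def)
    then have "neighbours G v \<noteq> {c}" by force
    \<comment> \<open>A neighbour of \<open>v\<close> other than \<open>c\<close> is not adjacent to
      \<open>c\<close>, as there are no triangles, and is therefore a leaf.\<close>
    then obtain l where l: "l \<in> neighbours G v" "l \<noteq> c" using Nc(2)[OF v] by blast
    have "l \<notin> neighbours G c" using no_triangle[of v c l] Nc(1)[OF v] l(1) by blast
    then have "l \<in> ?L" using inner[of l] l neighbours_subset[of v] by auto
    then show ?thesis using l by blast
  qed
  then obtain f where f: "\<And>v. v \<in> N \<Longrightarrow> f v \<in> ?L" "\<And>v. v \<in> N \<Longrightarrow> f v \<in> neighbours G v" by metis
  have nf: "neighbours G (f v) = {v}" if "v \<in> N" for v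
    using f[OF that] neighbours_sym[of "f v" v] by (auto simp: leaves_def card_1_singleton_iff)
  \<comment> \<open>The leaf \<open>f v\<close> determines \<open>v\<close> as its only
    neighbour.\<close>
  have inj: "inj_on f N" by (rule inj_onI) (metis nf the_elem_eq)
  have fN: "f ` N \<subseteq> ?L" using f by auto
  have card_V: "card ?V = Suc (card N + card ?L)"
  proof -
    have "N \<inter> ?L = {}" "c \<notin> N \<union> ?L" using cL by (auto simp: N_def)
    then have "card (insert c (N \<union> ?L)) = Suc (card N + card ?L)"
      using finN finL by (simp add: card_Un_disjoint)
    then show ?thesis using V by simp
  qed
  have d1: "d > 1"
  proof -
    \<comment> \<open>Three vertices already give \<open>d \<ge> 4 / 3\<close>.\<close>
    have "card {c, a, b} \<le> card ?V"
      using c ab neighbours_subset[of c] by (intro card_mono) auto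
    moreover have "c \<noteq> a" "c \<noteq> b" using ab not_self_neighbour by auto
    ultimately have "card ?V \<ge> 3" using ab by simp
    then show ?thesis unfolding d by (simp add: field_simps)
  qed
  have "card N \<le> card ?L" using card_inj_on_le[OF inj fN finL] .
  then consider "card N < card ?L" | "card N = card ?L" by linarith
  then show ?thesis
  proof cases
    case 1
    then show ?thesis using laplacian_count_ge_card_leaves[OF c cL d1] card_V by simp
  next
    case 2
    \<comment> \<open>Equal cardinalities leave no leaf outside the image of the injection
      \<open>f\<close>.\<close>
    have fL: "f ` N = ?L"
      using 2 fN finL inj by (intro card_subset_eq) (auto simp: card_image)
    have nN: "neighbours G v = {c, f v}" if v: "v \<in> N" for v
    proof
      show "{c, f v} \<subseteq> neighbours G v" using Nc[OF v] f(2)[OF v] by simp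
      show "neighbours G v \<subseteq> {c, f v}"
      proof
        fix w assume w: "w \<in> neighbours G v"
        then consider "w = c" | "w \<in> N" | u where "u \<in> N" "w = f u"
          using neighbours_subset[of v] V fL by blast
        then show "w \<in> {c, f v}"
        proof cases
          case 2
          then show ?thesis using no_triangle[of v c w] Nc v w by blast
        next
          case 3
          \<comment> \<open>The only neighbour of \<open>f u\<close> is \<open>u\<close>, so
            \<open>u = v\<close>.\<close>
          then show ?thesis using nf[of u] w neighbours_sym[of w v] by auto
        qed simp
      qed
    qed
    have nc: "neighbours G c = N"
    proof
      show "N \<subseteq> neighbours G c" using Nc by auto
      show "neighbours G c \<subseteq> N"
      proof
        fix w assume w: "w \<in> neighbours G c"
        then consider "w = c" | "w \<in> N" | u where "u \<in> N" "w = f u"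
          using neighbours_subset[of c] V fL by blast
        then show "w \<in> N"
        proof cases
          case 1
          then show ?thesis using w not_self_neighbour by simp
        next
          case 3
          \<comment> \<open>A leaf \<open>f u\<close> adjacent to \<open>c\<close> would force
            \<open>c = u\<close>.\<close>
          then have "c \<in> N" using nf[of u] w neighbours_sym[of w c] by auto
          then show ?thesis by (simp add: N_def)
        qed
      qed
    qed
    have "Suc (card N) \<le> laplacian_count G {0..<d}"
    proof (rule laplacian_count_spider[OF _ _ inj _ _ nc nN nf _ d])
      show "c \<notin> N" "N \<inter> f ` N = {}" unfolding fL by (auto simp: N_def)
      show "c \<notin> f ` N" unfolding fL by (rule cL)
      show "?V = insert c (N \<union> f ` N)" unfolding fL by (rule V)
      show "N \<noteq> {}" using nc ab(2) by blast
    qed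
    then show ?thesis using 2 card_V by simp
  qed
qed

end

theorem theorem10:
  fixes T :: "('a, 'b) pre_digraph" and n :: nat and d :: real
  assumes "undirected_tree T"
    and "diameter T = 4"
    and "n = card (verts T)"
    and "d = 2 - 2 / real n"
  shows "int (laplacian_count T {0..<d}) \<ge> \<lceil>real n / 2\<rceil>"
proof -
  interpret graph T using assms(1) by (simp add: undirected_tree_def)
  interpret undirected_tree_graph T
    using assms(1) by unfold_locales (auto simp: undirected_tree_def not_le[symmetric])
  have "n \<le> 2 * laplacian_count T {0..<d}"
    using laplacian_count_diameter_4 assms(2-4) by simp
  then show ?thesis by (simp add: ceiling_le_iff)
qed

end
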